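(* For every $n\ge 2$, both the weak rectangulotope $\mathbb{WR}(n)$ and the strong rectangulotope $\mathbb{SR}(n)$ have exactly $2^n-2$ facets, one for each subset $\varnothing\ne X\subsetneq[n]$ (the facet corresponding to $X$ having outer normal vector $\sum_{i\in X}\boldsymbol{e}_i$, modulo $(1,\dots,1)$).
   Context: Notation: $[n]=\{1,\dots,n\}$, $\boldsymbol{e}_1,\dots,\boldsymbol{e}_n$ is the standard basis of $\mathbb{R}^n$. Rectangulations. A rectangulation of size $n$ is a decomposition of an axis-parallel square into $n$ axis-parallel rectangles with disjoint interiors; all rectangulations are assumed generic, i.e. no four rectangles have a common vertex. The segments of a rectangulation are the inclusionwise maximal line segments composed of edges of the rectangles, excluding the edges of the square. A rectangle $r$ is above a rectangle $s$ (and $s$ is below $r$) if there is a sequence $r=r_0,\dots,r_k=s$ ($k\ge1$) of rectangles such that the bottom edge of $r_{i-1}$ lies in the same segment as the top edge of $r_i$ for all $i\in[k]$; "on the left of" and "on the right of" are defined similarly. Two rectangulations are weakly equivalent if there is a bijection between their rectangles preserving both the relation "$r$ is above $s$" and the relation "$r$ is on the left of $s$", and strongly equivalent if the bijection moreover preserves the adjacency relation; weak (resp. strong) rectangulations are the weak (resp. strong) equivalence classes. The rectangles of $R$ are labeled by $[n]$ by the total order in which $i<j$ when $r_j$ is below or on the right of $r_i$ (where $r_i$ is the rectangle labeled $i$). Weak poset. For a rectangle $r$, let $s(r)$ be its bottom--left corner and $t(r)$ its top--right corner. Consider the directed graph on all vertices of $R$ with, for each rectangle, the four edges joining its consecutive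 corners, horizontal ones oriented left to right, vertical ones bottom to top. The source tree $S(R)$ (resp. target tree $T(R)$) is the subgraph induced by the points $s(r_i)$ (resp. $t(r_i)$), with $s(r_i)$ (resp. $t(r_i)$) labeled $i$. The weak poset $\prec_w^R$ on $[n]$ is the transitive closure of the union of the edge relations of $S(R)$ and $T(R)$ (an edge $i\to j$ gives $i\prec_w^R j$). Strong poset. The adjacency poset $\lhd$ of $R$ is the transitive closure of the directed graph on $[n]$ obtained from the adjacency graph of the rectangles by orienting edges from left to right and from bottom to top. The special relation has $i\blacktriangleleft j$ if either the right side of $r_j$ and the left side of $r_i$ lie on the same vertical segment and the bottom--right corner of $r_j$ is above the top--left corner of $r_i$, or the top side of $r_j$ and the bottom side of $r_i$ lie on the same horizontal segment and the top--left corner of $r_j$ lies on the right of the bottom--right corner of $r_i$. The strong poset $\prec_s^R$ is the transitive closure of the union of $\lhd$ and $\blacktriangleleft$. Rectangulotopes. $\mathbb{WR}(n)$ (resp. $\mathbb{SR}(n)$) is a polytope in $\mathbb{R}^n$ whose normal fan is the complete fan with maximal cones $\{x\in\mathbb{R}^n: x_i\le x_j\text{ whenever } i\prec_w^R j\}$ for all weak rectangulations $R$ of size $n$ (resp. $\{x\in\mathbb{R}^n: x_i\le x_j\text{ whenever } i\prec_s^R j\}$ for all strong rectangulations $R$ of size $n$). The normal cone of a face $F$ of a polytope $P$ is the set of $v$ such that $x\mapsto\langle v,x\rangle$ is maximized over $P$ at every point of $F$. Such polytopes have dimension $n-1$ and lie in a hyperplane orthogonal to $(1,\dots,1)$. 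*)

theory Defs
  imports "HOL-Analysis.Analysis"
begin

section \<open>Rectangles in the plane\<close>

datatype rect = Rect (x_left: real) (x_right: real) (y_bottom: real) (y_top: real)

definition proper :: "rect \<Rightarrow> bool" where
  "proper r \<longleftrightarrow> x_left r < x_right r \<and> y_bottom r < y_top r"

definition bottom_left :: "rect \<Rightarrow> real \<times> real" where
  "bottom_left r = (x_left r, y_bottom r)"

definition bottom_right :: "rect \<Rightarrow> real \<times> real" where
  "bottom_right r = (x_right r, y_bottom r)"

definition top_left :: "rect \<Rightarrow> real \<times> real" where
  "top_left r = (x_left r, y_top r)"

definition top_right :: "rect \<Rightarrow> real \<times> real" where
  "top_right r = (x_right r, y_top r)"

definition corners :: "rect \<Rightarrow> (real \<times> real) set" where
  "corners r = {bottom_left r, bottom_right r, top_left r, top_right r}"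

definition region :: "rect \<Rightarrow> (real \<times> real) set" where
  "region r = cbox (bottom_left r) (top_right r)"

definition left_edge :: "rect \<Rightarrow> (real \<times> real) set" where
  "left_edge r = closed_segment (bottom_left r) (top_left r)"

definition right_edge :: "rect \<Rightarrow> (real \<times> real) set" where
  "right_edge r = closed_segment (bottom_right r) (top_right r)"

definition bottom_edge :: "rect \<Rightarrow> (real \<times> real) set" where
  "bottom_edge r = closed_segment (bottom_left r) (bottom_right r)"

definition top_edge :: "rect \<Rightarrow> (real \<times> real) set" where
  "top_edge r = closed_segment (top_left r) (top_right r)"

definition edges :: "rect \<Rightarrow> (real \<times> real) set set" where
  "edges r = {left_edge r, right_edge r, bottom_edge r, top_edge r}"

section \<open>Generic rectangulations\<close>

definition is_square :: "rect \<Rightarrow> bool" where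
  "is_square q \<longleftrightarrow> proper q \<and> x_right q - x_left q = y_top q - y_bottom q"

definition generic :: "rect set \<Rightarrow> bool" where
  "generic R \<longleftrightarrow> \<not> (\<exists>A p. A \<subseteq> R \<and> card A = 4 \<and> (\<forall>r\<in>A. p \<in> corners r))"

definition rectangulations :: "nat \<Rightarrow> rect set set" where
  "rectangulations n = {R. finite R \<and> card R = n \<and> (\<forall>r\<in>R. proper r)
     \<and> (\<exists>q. is_square q \<and> (\<Union>r\<in>R. region r) = region q)
     \<and> pairwise (\<lambda>r s. interior (region r) \<inter> interior (region s) = {}) R
     \<and> generic R}"

definition line_of_edges :: "rect set \<Rightarrow> (real \<times> real) set \<Rightarrow> bool" where
  "line_of_edges R l \<longleftrightarrow> (\<exists>a b. a \<noteq> b \<and> l = closed_segment a b)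
     \<and> (\<exists>E. E \<subseteq> (\<Union>r\<in>R. edges r) \<and> l = \<Union>E)"

(* The edges of the square are the maximal lines contained in its frontier. *)
definition segments :: "rect set \<Rightarrow> (real \<times> real) set set" where
  "segments R = {l. line_of_edges R l \<and> (\<forall>m. line_of_edges R m \<and> l \<subseteq> m \<longrightarrow> m = l)
     \<and> \<not> l \<subseteq> frontier (\<Union>r\<in>R. region r)}"

definition above :: "rect set \<Rightarrow> rect \<Rightarrow> rect \<Rightarrow> bool" where
  "above R = (\<lambda>r s. r \<in> R \<and> s \<in> R
     \<and> (\<exists>l\<in>segments R. bottom_edge r \<subseteq> l \<and> top_edge s \<subseteq> l))\<^sup>+\<^sup>+"

definition left_of :: "rect set \<Rightarrow> rect \<Rightarrow> rect \<Rightarrow> bool" where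
  "left_of R = (\<lambda>r s. r \<in> R \<and> s \<in> R
     \<and> (\<exists>l\<in>segments R. right_edge r \<subseteq> l \<and> left_edge s \<subseteq> l))\<^sup>+\<^sup>+"

(* Sides count as adjacent only if they overlap in a segment of positive length. *)
definition adjacent_left_right :: "rect \<Rightarrow> rect \<Rightarrow> bool" where
  "adjacent_left_right r s \<longleftrightarrow> x_right r = x_left s
     \<and> max (y_bottom r) (y_bottom s) < min (y_top r) (y_top s)"

definition adjacent_bottom_top :: "rect \<Rightarrow> rect \<Rightarrow> bool" where
  "adjacent_bottom_top r s \<longleftrightarrow> y_top r = y_bottom s
     \<and> max (x_left r) (x_left s) < min (x_right r) (x_right s)"

definition adjacent :: "rect \<Rightarrow> rect \<Rightarrow> bool" where
  "adjacent r s \<longleftrightarrow> adjacent_left_right r s \<or> adjacent_left_right s r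
     \<or> adjacent_bottom_top r s \<or> adjacent_bottom_top s r"

definition weak_bijection :: "rect set \<Rightarrow> rect set \<Rightarrow> (rect \<Rightarrow> rect) \<Rightarrow> bool" where
  "weak_bijection R R' f \<longleftrightarrow> bij_betw f R R'
     \<and> (\<forall>r\<in>R. \<forall>s\<in>R. (above R r s \<longleftrightarrow> above R' (f r) (f s))
                     \<and> (left_of R r s \<longleftrightarrow> left_of R' (f r) (f s)))"

definition weakly_equivalent :: "rect set \<Rightarrow> rect set \<Rightarrow> bool" where
  "weakly_equivalent R R' \<longleftrightarrow> (\<exists>f. weak_bijection R R' f)"

definition strongly_equivalent :: "rect set \<Rightarrow> rect set \<Rightarrow> bool" where
  "strongly_equivalent R R' \<longleftrightarrow> (\<exists>f. weak_bijection R R' f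
     \<and> (\<forall>r\<in>R. \<forall>s\<in>R. adjacent r s \<longleftrightarrow> adjacent (f r) (f s)))"

definition weak_rectangulations :: "nat \<Rightarrow> rect set set set" where
  "weak_rectangulations n = rectangulations n //
     {(R, R'). R \<in> rectangulations n \<and> R' \<in> rectangulations n \<and> weakly_equivalent R R'}"

definition strong_rectangulations :: "nat \<Rightarrow> rect set set set" where
  "strong_rectangulations n = rectangulations n //
     {(R, R'). R \<in> rectangulations n \<and> R' \<in> rectangulations n \<and> strongly_equivalent R R'}"

section \<open>The weak and the strong poset\<close>

text \<open>The label set \<open>[n]\<close> is a finite linearly ordered type \<open>'n\<close> with \<open>n\<close> elements, which also
  indexes the coordinates of \<open>real ^ 'n\<close>.\<close>

definition labeling :: "rect set \<Rightarrow> ('n::{finite,linorder} \<Rightarrow> rect) \<Rightarrow> bool" where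
  "labeling R r \<longleftrightarrow> bij_betw r UNIV R
     \<and> (\<forall>i j. i < j \<longleftrightarrow> above R (r i) (r j) \<or> left_of R (r i) (r j))"

(* Arcs join consecutive corners of one rectangle, passing over any vertex in between. *)
definition corner_arcs :: "rect set \<Rightarrow> ((real \<times> real) \<times> (real \<times> real)) set" where
  "corner_arcs R = (\<Union>r\<in>R. {(bottom_left r, bottom_right r), (top_left r, top_right r),
                             (bottom_left r, top_left r), (bottom_right r, top_right r)})"

definition source_tree :: "rect set \<Rightarrow> ('n::{finite,linorder} \<Rightarrow> rect) \<Rightarrow> 'n \<Rightarrow> 'n \<Rightarrow> bool" where
  "source_tree R r i j \<longleftrightarrow> (bottom_left (r i), bottom_left (r j)) \<in> corner_arcs R"

definition target_tree :: "rect set \<Rightarrow> ('n::{finite,linorder} \<Rightarrow> rect) \<Rightarrow> 'n \<Rightarrow> 'n \<Rightarrow> bool" where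
  "target_tree R r i j \<longleftrightarrow> (top_right (r i), top_right (r j)) \<in> corner_arcs R"

definition weak_less :: "rect set \<Rightarrow> ('n::{finite,linorder} \<Rightarrow> rect) \<Rightarrow> 'n \<Rightarrow> 'n \<Rightarrow> bool" where
  "weak_less R r = (\<lambda>i j. source_tree R r i j \<or> target_tree R r i j)\<^sup>+\<^sup>+"

definition adjacency_less :: "('n::{finite,linorder} \<Rightarrow> rect) \<Rightarrow> 'n \<Rightarrow> 'n \<Rightarrow> bool" where
  "adjacency_less r =
     (\<lambda>i j. adjacent_left_right (r i) (r j) \<or> adjacent_bottom_top (r i) (r j))\<^sup>+\<^sup>+"

definition special :: "rect set \<Rightarrow> ('n::{finite,linorder} \<Rightarrow> rect) \<Rightarrow> 'n \<Rightarrow> 'n \<Rightarrow> bool" where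
  "special R r i j \<longleftrightarrow>
     (\<exists>l\<in>segments R. right_edge (r j) \<subseteq> l \<and> left_edge (r i) \<subseteq> l
        \<and> snd (bottom_right (r j)) > snd (top_left (r i)))
   \<or> (\<exists>l\<in>segments R. top_edge (r j) \<subseteq> l \<and> bottom_edge (r i) \<subseteq> l
        \<and> fst (top_left (r j)) > fst (bottom_right (r i)))"

definition strong_less :: "rect set \<Rightarrow> ('n::{finite,linorder} \<Rightarrow> rect) \<Rightarrow> 'n \<Rightarrow> 'n \<Rightarrow> bool" where
  "strong_less R r = (\<lambda>i j. adjacency_less r i j \<or> special R r i j)\<^sup>+\<^sup>+"

section \<open>Normal fans and rectangulotopes\<close>

definition order_cone :: "('n::finite \<Rightarrow> 'n \<Rightarrow> bool) \<Rightarrow> (real ^ 'n) set" where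
  "order_cone prec = {x. \<forall>i j. prec i j \<longrightarrow> x $ i \<le> x $ j}"

definition weak_cones :: "(real ^ 'n::{finite,linorder}) set set" where
  "weak_cones = {order_cone (weak_less R r) | R r.
     (\<exists>W \<in> weak_rectangulations CARD('n). R \<in> W) \<and> labeling R r}"

definition strong_cones :: "(real ^ 'n::{finite,linorder}) set set" where
  "strong_cones = {order_cone (strong_less R r) | R r.
     (\<exists>S \<in> strong_rectangulations CARD('n). R \<in> S) \<and> labeling R r}"

definition normal_cone :: "'a::euclidean_space set \<Rightarrow> 'a set \<Rightarrow> 'a set" where
  "normal_cone P F = {v. \<forall>x\<in>F. \<forall>y\<in>P. v \<bullet> y \<le> v \<bullet> x}"

definition normal_fan :: "'a::euclidean_space set \<Rightarrow> 'a set set" where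
  "normal_fan P = {normal_cone P F | F. F face_of P \<and> F \<noteq> {}}"

definition maximal_cones :: "'a set set \<Rightarrow> 'a set set" where
  "maximal_cones \<F> = {C \<in> \<F>. \<forall>D\<in>\<F>. C \<subseteq> D \<longrightarrow> D = C}"

(* The normal fan of a nonempty polytope is complete and determined by its maximal cones. *)
definition weak_rectangulotope :: "(real ^ 'n::{finite,linorder}) set \<Rightarrow> bool" where
  "weak_rectangulotope P \<longleftrightarrow> polytope P \<and> maximal_cones (normal_fan P) = weak_cones"

definition strong_rectangulotope :: "(real ^ 'n::{finite,linorder}) set \<Rightarrow> bool" where
  "strong_rectangulotope P \<longleftrightarrow> polytope P \<and> maximal_cones (normal_fan P) = strong_cones"

(* v is an outer normal vector of the facet F, unique up to positive factors and modulo (1,...,1). *)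
definition outer_normal_mod_one :: "(real ^ 'n) set \<Rightarrow> (real ^ 'n) set \<Rightarrow> real ^ 'n \<Rightarrow> bool" where
  "outer_normal_mod_one P F v \<longleftrightarrow>
     normal_cone P F = {a *\<^sub>R v + b *\<^sub>R (1 :: real ^ 'n) | a b. a \<ge> 0}"

end

theory Submission
  imports Defs
begin

text \<open>In every rectangulation the rectangle at the top-right corner is the greatest and the one at the
  bottom-left corner is the least element of the weak and of the strong poset: at any other top-right
  corner of a rectangle, a neighbour to the right or above shares a corner point with it, and that
  neighbour is a successor in the target tree as well as in the adjacency poset.

  Let \<open>F\<close> be the face of \<open>P\<close> maximizing the indicator \<open>1\<^sub>X\<close> and let \<open>v\<close> be a vertex of \<open>F\<close>. Its normal
  cone is the order cone of a poset in which \<open>X\<close> is an up-set. If \<open>y\<close> is normal to \<open>F\<close>, then both \<open>y\<close>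
  and \<open>1\<^sub>X - e y\<close>, for small \<open>e > 0\<close>, are monotone, so \<open>y\<close> is constant along relations inside \<open>X\<close> and
  inside its complement. As the greatest element lies in \<open>X\<close> and the least one outside, \<open>y\<close> is constant
  on \<open>X\<close> and on its complement; so \<open>F\<close> is a facet. Conversely, a normal vector of a facet remains in
  the order cone after subtracting a small multiple of the indicator of the set where it attains its
  maximum, and so this indicator is normal to the facet, too.\<close>

section \<open>Polytopes whose normal cones are order cones\<close>

definition maximizers :: "'a::euclidean_space set \<Rightarrow> 'a \<Rightarrow> 'a set" where
  "maximizers P c = {x \<in> P. \<forall>y\<in>P. c \<bullet> y \<le> c \<bullet> x}"

lemma maximizers_face_of:
  assumes "convex P"
  shows "maximizers P c face_of P"
proof (cases "maximizers P c = {}")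
  case False
  then obtain x where x: "x \<in> P" "\<And>y. y \<in> P \<Longrightarrow> c \<bullet> y \<le> c \<bullet> x"
    by (auto simp: maximizers_def)
  then have "maximizers P c = P \<inter> {y. c \<bullet> y = c \<bullet> x}"
    unfolding maximizers_def by (auto intro: antisym)
  with x assms show ?thesis
    by (simp add: face_of_Int_supporting_hyperplane_le)
qed auto

lemma maximizers_nonempty:
  assumes "compact P" "P \<noteq> {}"
  shows "maximizers P c \<noteq> {}"
proof -
  have "continuous_on P (\<lambda>x. c \<bullet> x)" by (intro continuous_intros)
  from continuous_attains_sup[OF assms this] show ?thesis
    by (auto simp: maximizers_def)
qed

lemma mem_normal_cone_iff:
  assumes "F \<subseteq> P"
  shows "c \<in> normal_cone P F \<longleftrightarrow> F \<subseteq> maximizers P c"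
  using assms by (auto simp: normal_cone_def maximizers_def)

lemma normal_cone_antimono: "F \<subseteq> G \<Longrightarrow> normal_cone P G \<subseteq> normal_cone P F"
  by (auto simp: normal_cone_def)

text \<open>Faces of polyhedra are exposed; a point of \<open>F\<close> shows that the offset
  \<open>b\<close> is the maximum of \<open>a\<close> over \<open>P\<close>.\<close>

lemma face_of_polytope_eq_maximizers:
  assumes "polytope P" "F face_of P" "F \<noteq> {}"
  obtains c where "F = maximizers P c"
proof -
  have "F exposed_face_of P"
    using assms by (simp add: exposed_face_of_polyhedron polytope_imp_polyhedron)
  then obtain a b where ab: "P \<subseteq> {x. a \<bullet> x \<le> b}" "F = P \<inter> {x. a \<bullet> x = b}"
    unfolding exposed_face_of_def by blast
  obtain z where "z \<in> F" using assms(3) by blast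
  then have "F = maximizers P a"
    using ab unfolding maximizers_def by fastforce
  then show thesis by (rule that)
qed

text \<open>A functional \<open>c\<close> exposing the vertex lies in the normal cone of a face
  \<open>F\<close> only if \<open>F\<close> is contained in \<open>{v}\<close>. This links the
  vertices to the maximal cones prescribed for a rectangulotope.\<close>

lemma normal_cone_vertex_maximal:
  assumes "polytope P" "v extreme_point_of P"
  shows "normal_cone P {v} \<in> maximal_cones (normal_fan P)"
proof -
  have face: "{v} face_of P" using assms(2) by (simp add: face_of_singleton)
  obtain c where c: "{v} = maximizers P c"
    using face_of_polytope_eq_maximizers[OF assms(1) face] by blast
  have "normal_cone P F = normal_cone P {v}"
    if F: "F face_of P" "F \<noteq> {}" and sub: "normal_cone P {v} \<subseteq> normal_cone P F" for F
  proof -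
    have "{v} \<subseteq> P" using face face_of_imp_subset by blast
    then have "c \<in> normal_cone P {v}" using c by (simp add: mem_normal_cone_iff)
    then have "c \<in> normal_cone P F" using sub by blast
    then have "F \<subseteq> {v}"
      using c mem_normal_cone_iff[OF face_of_imp_subset[OF F(1)]] by simp
    then have "F = {v}" using F(2) by blast
    then show ?thesis by simp
  qed
  then show ?thesis
    using face unfolding maximal_cones_def normal_fan_def by blast
qed

text \<open>That is, \<open>c\<close> lies in the relative interior of the normal cone of the face it exposes.\<close>

lemma normal_cone_maximizers_absorbing:
  assumes "polytope P" "y \<in> normal_cone P (maximizers P c)"
  obtains e where "e > 0" "c - e *\<^sub>R y \<in> normal_cone P (maximizers P c)"
proof -
  obtain V where V: "finite V" "P = convex hull V"
    using assms(1) unfolding polytope_def by blast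
  let ?M = "maximizers P c"
  \<comment> \<open>If \<open>c\<close> ties at \<open>w\<close> and \<open>x\<close>, then both are
    maximizers and \<open>y\<close> ties as well; otherwise the strict inequality for
    \<open>c\<close> survives a small perturbation.\<close>
  have ev: "\<forall>\<^sub>F e in at_right 0. (c - e *\<^sub>R y) \<bullet> w \<le> (c - e *\<^sub>R y) \<bullet> x"
    if "w \<in> P" "x \<in> ?M" for w x
  proof (cases "c \<bullet> w = c \<bullet> x")
    case True
    then have "w \<in> ?M" using that unfolding maximizers_def by simp
    then have "y \<bullet> w = y \<bullet> x"
      using assms(2) that by (auto simp: normal_cone_def maximizers_def intro: antisym)
    then show ?thesis using True by (simp add: inner_diff_left)
  next
    case False
    then have "0 < (c - 0 *\<^sub>R y) \<bullet> x - (c - 0 *\<^sub>R y) \<bullet> w"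
      using that by (auto simp: maximizers_def less_le)
    moreover have "((\<lambda>e. (c - e *\<^sub>R y) \<bullet> x - (c - e *\<^sub>R y) \<bullet> w)
        \<longlongrightarrow> (c - 0 *\<^sub>R y) \<bullet> x - (c - 0 *\<^sub>R y) \<bullet> w) (at_right 0)"
      by (intro tendsto_intros)
    ultimately have "\<forall>\<^sub>F e in at_right 0. 0 < (c - e *\<^sub>R y) \<bullet> x - (c - e *\<^sub>R y) \<bullet> w"
      by (rule order_tendstoD(1)[rotated])
    then show ?thesis by (rule eventually_mono) simp
  qed
  show thesis
  proof (cases "?M = {}")
    case True
    then have "c - 1 *\<^sub>R y \<in> normal_cone P ?M" by (simp add: normal_cone_def)
    then show ?thesis using that[of 1] by simp
  next
    case False
    then obtain x0 where x0: "x0 \<in> ?M" by blast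
    have "V \<subseteq> P" using V hull_subset by metis
    \<comment> \<open>A single \<open>e\<close> serves all points of the finite set
      \<open>V\<close>, hence its hull \<open>P\<close>. Comparing with one \<open>x0\<close>
      suffices, as \<open>c\<close> and \<open>y\<close> are both constant on
      \<open>?M\<close>.\<close>
    then have "\<forall>\<^sub>F e in at_right 0. \<forall>w\<in>V. (c - e *\<^sub>R y) \<bullet> w \<le> (c - e *\<^sub>R y) \<bullet> x0"
      using ev x0 V(1) by (intro eventually_ball_finite) auto
    then have "\<forall>\<^sub>F e in at_right 0. (\<forall>w\<in>V. (c - e *\<^sub>R y) \<bullet> w \<le> (c - e *\<^sub>R y) \<bullet> x0) \<and> e > 0"
      by (intro eventually_conj) (auto simp: eventually_at_right_less)
    then obtain e :: real where e: "e > 0" "\<forall>w\<in>V. (c - e *\<^sub>R y) \<bullet> w \<le> (c - e *\<^sub>R y) \<bullet> x0"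
      using eventually_happens' trivial_limit_at_right_real by blast
    have "P \<subseteq> {w. (c - e *\<^sub>R y) \<bullet> w \<le> (c - e *\<^sub>R y) \<bullet> x0}"
      unfolding V(2) by (rule hull_minimal) (use e in \<open>auto simp: convex_halfspace_le\<close>)
    moreover have "(c - e *\<^sub>R y) \<bullet> x = (c - e *\<^sub>R y) \<bullet> x0" if "x \<in> ?M" for x
    proof -
      have "c \<bullet> x = c \<bullet> x0" using that x0 by (auto simp: maximizers_def intro: antisym)
      moreover have "y \<bullet> x = y \<bullet> x0"
        using assms(2) that x0 by (auto simp: normal_cone_def maximizers_def intro: antisym)
      ultimately show ?thesis by (simp add: inner_diff_left)
    qed
    ultimately have "c - e *\<^sub>R y \<in> normal_cone P ?M"
      unfolding normal_cone_def by auto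
    then show ?thesis using that e by blast
  qed
qed

section \<open>Indicator vectors in order cones of bounded posets\<close>

definition bounded_prec :: "('a \<Rightarrow> 'a \<Rightarrow> bool) \<Rightarrow> bool" where
  "bounded_prec prec \<longleftrightarrow> (\<exists>m. \<forall>i. i = m \<or> prec i m) \<and> (\<exists>m. \<forall>i. i = m \<or> prec m i)"

abbreviation indicator_vec :: "'n set \<Rightarrow> real ^ 'n::finite" where
  "indicator_vec X \<equiv> (\<Sum>i\<in>X. axis i 1)"

lemma indicator_vec_nth: "indicator_vec X $ i = (if i \<in> X then 1 else 0)"
  by (simp add: axis_def if_distrib[of "\<lambda>f. f _"] sum.delta')

text \<open>A ray modulo the all-ones vector, since \<open>b\<close> has arbitrary sign: the normal
  cone that the facet of \<open>X\<close> will have.\<close>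

definition indicator_ray :: "'n set \<Rightarrow> (real ^ 'n::finite) set" where
  "indicator_ray X = {a *\<^sub>R indicator_vec X + b *\<^sub>R 1 | a b. a \<ge> 0}"

text \<open>Comparing coordinates inside and outside \<open>X\<close> forces \<open>b = 0\<close>
  and \<open>a = -1\<close>. This serves to show that the indicator is not constant on
  \<open>P\<close>.\<close>

lemma mem_indicator_ray_minus:
  assumes "X \<noteq> {}" "X \<noteq> UNIV"
  shows "- indicator_vec X \<notin> indicator_ray X"
proof
  assume "- indicator_vec X \<in> indicator_ray X"
  then obtain a b where ab: "- indicator_vec X = a *\<^sub>R indicator_vec X + b *\<^sub>R (1 :: real ^ 'a)" "a \<ge> 0"
    by (auto simp: indicator_ray_def)
  obtain i j where "i \<in> X" "j \<notin> X" using assms by blast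
  then have "-1 = a + b" "0 = b"
    using arg_cong[OF ab(1), of "\<lambda>v. v $ i"] arg_cong[OF ab(1), of "\<lambda>v. v $ j"]
    by (simp_all add: indicator_vec_nth del: sum_component)
  with ab(2) show False by simp
qed

lemma indicator_ray_inj:
  assumes "indicator_ray X = indicator_ray Y" "X \<noteq> {}" "X \<noteq> UNIV"
  shows "X = Y"
proof -
  have "indicator_vec X = 1 *\<^sub>R indicator_vec X + 0 *\<^sub>R 1 \<and> (0 :: real) \<le> 1" by simp
  then have "indicator_vec X \<in> indicator_ray X"
    unfolding indicator_ray_def by blast
  then have "indicator_vec X \<in> indicator_ray Y" unfolding assms(1) .
  then obtain a b where ab: "indicator_vec X = a *\<^sub>R indicator_vec Y + b *\<^sub>R (1 :: real ^ 'a)" "a \<ge> 0"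
    by (auto simp: indicator_ray_def)
  have nth: "(if k \<in> X then 1 else 0) = a * (if k \<in> Y then 1 else 0) + b" for k
    using arg_cong[OF ab(1), of "\<lambda>v. v $ k"]
    by (simp add: indicator_vec_nth del: sum_component)
  obtain i j where ij: "i \<in> X" "j \<notin> X" using assms by blast
  \<comment> \<open>If \<open>j\<close> were in \<open>Y\<close>, then \<open>a + b = 0\<close>, and
    the coordinate \<open>i\<close> would give \<open>b = 1\<close>, so
    \<open>a = -1\<close>.\<close>
  have "j \<notin> Y" using nth[of i] nth[of j] ij ab(2) by (auto split: if_splits)
  then have "b = 0" using nth[of j] ij by simp
  then show ?thesis using nth by (metis add.right_neutral ij mult_zero_right mult.right_neutral set_eqI zero_neq_one)
qed

lemma indicator_vec_mem_order_cone_iff: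
  "indicator_vec X \<in> order_cone prec \<longleftrightarrow> (\<forall>i j. prec i j \<and> i \<in> X \<longrightarrow> j \<in> X)"
  by (simp add: order_cone_def indicator_vec_nth del: sum_component) auto

lemma order_cone_opposite:
  assumes "bounded_prec prec" "X \<noteq> {}" "X \<noteq> UNIV"
    and X: "indicator_vec X \<in> order_cone prec"
    and y: "y \<in> order_cone prec" "indicator_vec X - e *\<^sub>R y \<in> order_cone prec" "e > 0"
  shows "y \<in> indicator_ray X"
proof -
  obtain t s where t: "\<And>i. i = t \<or> prec i t" and s: "\<And>i. i = s \<or> prec s i"
    using assms(1) unfolding bounded_prec_def by blast
  have up: "j \<in> X" if "prec i j" "i \<in> X" for i j
    using that X by (auto simp: indicator_vec_mem_order_cone_iff)
  have tX: "t \<in> X" using assms(2) t up by (metis ex_in_conv)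
  have sX: "s \<notin> X" using assms(3) s up by (metis UNIV_eq_I)
  have mono: "y $ i \<le> y $ j" if "prec i j" for i j
    using y(1) that by (auto simp: order_cone_def)
  have anti: "y $ i = y $ j" if "prec i j" "i \<in> X \<longleftrightarrow> j \<in> X" for i j
  proof -
    have "(indicator_vec X - e *\<^sub>R y) $ i \<le> (indicator_vec X - e *\<^sub>R y) $ j"
      using y(2) that by (auto simp: order_cone_def)
    then have "e * y $ j \<le> e * y $ i"
      using that(2) by (simp add: indicator_vec_nth del: sum_component split: if_splits)
    then show ?thesis using mono[OF that(1)] \<open>e > 0\<close> by simp
  qed
  \<comment> \<open>\<open>t\<close> lies in the up-set \<open>X\<close> and \<open>s\<close>
    outside it, so every label can be compared with the one on its own side; hence \<open>y\<close>
    takes two values, the value at \<open>s\<close> being the smaller by monotonicity.\<close>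
  have "y = (y $ t - y $ s) *\<^sub>R indicator_vec X + (y $ s) *\<^sub>R 1"
  proof (rule vec_eq_iff[THEN iffD2], rule allI)
    fix i
    have "y $ i = (if i \<in> X then y $ t else y $ s)"
      using t[of i] s[of i] anti[of i t] anti[of s i] tX sX by auto
    then show "y $ i = ((y $ t - y $ s) *\<^sub>R indicator_vec X + (y $ s) *\<^sub>R 1) $ i"
      by (simp add: indicator_vec_nth del: sum_component)
  qed
  moreover have "y $ t - y $ s \<ge> 0"
    using t[of s] mono[of s t] by auto
  ultimately show ?thesis unfolding indicator_ray_def by blast
qed

text \<open>The top level set of a monotone \<open>c\<close> is an up-set. Subtracting its indicator
  can only spoil a relation entering \<open>X\<close> from outside, where \<open>c\<close> rises
  strictly; so \<open>e\<close> is taken at most the smallest positive gap between values of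
  \<open>c\<close>.\<close>

lemma top_level_set_perturbation:
  fixes c :: "real ^ 'n::finite"
  assumes c: "c \<in> order_cone prec" and X: "X = {i. \<forall>j. c $ j \<le> c $ i}"
  obtains e where "e > 0" "indicator_vec X \<in> order_cone prec"
    "c - e *\<^sub>R indicator_vec X \<in> order_cone prec"
proof -
  have mono: "c $ i \<le> c $ j" if "prec i j" for i j
    using c that by (auto simp: order_cone_def)
  have X1: "indicator_vec X \<in> order_cone prec"
    unfolding indicator_vec_mem_order_cone_iff X using mono by (auto intro: order_trans)
  have "\<forall>\<^sub>F e in at_right 0. c $ i < c $ j \<longrightarrow> e \<le> c $ j - c $ i" for i j
    by (cases "c $ i < c $ j")
       (auto intro: eventually_mono[OF eventually_at_right_real[of 0 "c $ j - c $ i"]])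
  then have "\<forall>\<^sub>F e in at_right 0. \<forall>i j. c $ i < c $ j \<longrightarrow> e \<le> c $ j - c $ i"
    by (intro eventually_all_finite)
  then have "\<forall>\<^sub>F e in at_right 0. (\<forall>i j. c $ i < c $ j \<longrightarrow> e \<le> c $ j - c $ i) \<and> e > 0"
    by (intro eventually_conj) (auto simp: eventually_at_right_less)
  then obtain e :: real where e: "e > 0" "\<And>i j. c $ i < c $ j \<Longrightarrow> e \<le> c $ j - c $ i"
    using eventually_happens' trivial_limit_at_right_real by blast
  have "c - e *\<^sub>R indicator_vec X \<in> order_cone prec"
    unfolding order_cone_def
  proof (intro CollectI allI impI)
    fix i j assume ij: "prec i j"
    have "c $ i - e * (if i \<in> X then 1 else 0) \<le> c $ j - e * (if j \<in> X then 1 else 0)"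
    proof (cases "j \<in> X \<and> i \<notin> X")
      case True
      then have "c $ i < c $ j" unfolding X by (smt (verit) mem_Collect_eq)
      then show ?thesis using e(2)[of i j] True by simp
    next
      case False
      then have "i \<in> X \<longleftrightarrow> j \<in> X"
        using X1 ij unfolding indicator_vec_mem_order_cone_iff by blast
      then show ?thesis using mono[OF ij] by simp
    qed
    then show "(c - e *\<^sub>R indicator_vec X) $ i \<le> (c - e *\<^sub>R indicator_vec X) $ j"
      by (simp add: indicator_vec_nth del: sum_component)
  qed
  with that e X1 show thesis by blast
qed

text \<open>Bundles what the facet argument uses of a rectangulotope, so that the weak and the
  strong case are treated at once.\<close>

locale order_cone_polytope =
  fixes P :: "(real ^ 'n::finite) set"
  assumes polytope: "polytope P" and nonempty: "P \<noteq> {}"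
    and vertex_cone: "v extreme_point_of P \<Longrightarrow>
          \<exists>prec. normal_cone P {v} = order_cone prec \<and> bounded_prec prec"
begin

lemma vertex_in_face:
  assumes "F face_of P" "F \<noteq> {}"
  obtains v prec where "v \<in> F" "v extreme_point_of P"
    "normal_cone P {v} = order_cone prec" "bounded_prec prec"
proof -
  have "polytope F" using assms(1) polytope face_of_polytope_polytope by blast
  then obtain v where v: "v extreme_point_of F"
    using assms(2) extreme_point_exists_convex polytope_imp_compact polytope_imp_convex by blast
  then have "v extreme_point_of P" "v \<in> F"
    using assms(1) extreme_point_of_face by blast+
  then show thesis using that vertex_cone by blast
qed

text \<open>Every order cone contains the all-ones vector and its negative, so both are maximized
  over \<open>P\<close> at the same vertex.\<close>

lemma inner_one_constant:
  assumes "x \<in> P" "y \<in> P"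
  shows "(1 :: real ^ 'n) \<bullet> x = 1 \<bullet> y"
proof -
  obtain v prec where v: "v \<in> P" "normal_cone P {v} = order_cone prec"
    using vertex_in_face[of P] nonempty polytope face_of_refl polytope_imp_convex by metis
  have "1 \<in> normal_cone P {v}" "- 1 \<in> normal_cone P {v}"
    unfolding v by (simp_all add: order_cone_def)
  then have "1 \<bullet> z = 1 \<bullet> v" if "z \<in> P" for z
    using that by (fastforce simp: normal_cone_def)
  then show ?thesis using assms by simp
qed

lemma maximizers_affine:
  assumes "a > 0"
  shows "maximizers P (a *\<^sub>R c + b *\<^sub>R 1) = maximizers P c"
  unfolding maximizers_def
proof (intro Collect_cong conj_cong ball_cong refl)
  fix x y assume "x \<in> P" "y \<in> P"
  then have "(1 :: real ^ 'n) \<bullet> x = 1 \<bullet> y" by (rule inner_one_constant)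
  then show "(a *\<^sub>R c + b *\<^sub>R 1) \<bullet> y \<le> (a *\<^sub>R c + b *\<^sub>R 1) \<bullet> x \<longleftrightarrow> c \<bullet> y \<le> c \<bullet> x"
    using assms by (simp add: inner_add_left)
qed

lemma maximizers_constant: "maximizers P (b *\<^sub>R 1) = P"
proof -
  have "(b *\<^sub>R 1) \<bullet> y \<le> (b *\<^sub>R 1) \<bullet> x" if "x \<in> P" "y \<in> P" for x y
    using inner_one_constant[OF that] by simp
  then show ?thesis unfolding maximizers_def by blast
qed

lemma maximizers_face: "maximizers P c face_of P" "maximizers P c \<noteq> {}" "maximizers P c \<subseteq> P"
  by (simp_all add: maximizers_face_of maximizers_nonempty nonempty polytope polytope_imp_compact
      polytope_imp_convex face_of_imp_subset)

text \<open>Vectors normal to the face lie in the order cone of each of its vertices. As the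
  indicator is absorbing in the normal cone, \<open>order_cone_opposite\<close> applies with the
  poset of one vertex.\<close>

lemma normal_cone_indicator:
  assumes "X \<noteq> {}" "X \<noteq> UNIV"
  shows "normal_cone P (maximizers P (indicator_vec X)) = indicator_ray X"
proof
  let ?F = "maximizers P (indicator_vec X)"
  show "normal_cone P ?F \<subseteq> indicator_ray X"
  proof
    fix y assume y: "y \<in> normal_cone P ?F"
    obtain v prec where v: "v \<in> ?F" "normal_cone P {v} = order_cone prec" "bounded_prec prec"
      using vertex_in_face maximizers_face by metis
    have sub: "normal_cone P ?F \<subseteq> order_cone prec"
      using normal_cone_antimono[of "{v}" ?F P] v by simp
    obtain e where "e > 0" "indicator_vec X - e *\<^sub>R y \<in> normal_cone P ?F"
      using normal_cone_maximizers_absorbing[OF polytope y] by blast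
    moreover have "indicator_vec X \<in> normal_cone P ?F"
      by (simp add: mem_normal_cone_iff maximizers_face)
    ultimately show "y \<in> indicator_ray X"
      using order_cone_opposite[OF v(3) assms] y sub by blast
  qed
  show "indicator_ray X \<subseteq> normal_cone P ?F"
  proof
    fix y assume "y \<in> indicator_ray X"
    then obtain a b where y: "y = a *\<^sub>R indicator_vec X + b *\<^sub>R 1" "a \<ge> 0"
      unfolding indicator_ray_def by blast
    \<comment> \<open>For \<open>a = 0\<close> the functional \<open>y\<close> is constant on
      \<open>P\<close> and exposes all of it.\<close>
    then have "?F \<subseteq> maximizers P y"
      using maximizers_affine[of a "indicator_vec X" b] maximizers_constant[of b] maximizers_face
      by (cases "a = 0") auto
    then show "y \<in> normal_cone P ?F"
      by (simp add: mem_normal_cone_iff maximizers_face)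
  qed
qed

lemma maximizers_indicator_neq:
  assumes "X \<noteq> {}" "X \<noteq> UNIV"
  shows "maximizers P (indicator_vec X) \<noteq> P"
proof
  assume eq: "maximizers P (indicator_vec X) = P"
  have "indicator_vec X \<bullet> x \<le> indicator_vec X \<bullet> y" if "x \<in> P" "y \<in> P" for x y
    using that eq[symmetric] unfolding maximizers_def by blast
  then have "- indicator_vec X \<in> normal_cone P P"
    unfolding normal_cone_def by simp
  then show False
    using normal_cone_indicator[OF assms] mem_indicator_ray_minus[OF assms] eq by simp
qed

text \<open>The exposed face lies in some facet \<open>G\<close>, and a functional exposing
  \<open>G\<close> is normal to the smaller face, hence on its ray. With \<open>a = 0\<close> it
  would expose \<open>P\<close>; otherwise it exposes the smaller face itself.\<close>

lemma maximizers_indicator_facet: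
  assumes "X \<noteq> {}" "X \<noteq> UNIV"
  shows "maximizers P (indicator_vec X) facet_of P"
proof -
  let ?F = "maximizers P (indicator_vec X)"
  obtain G where G: "G facet_of P" "?F \<subseteq> G"
    using face_of_polyhedron_subset_facet[OF polytope_imp_polyhedron[OF polytope] maximizers_face(1,2)]
      maximizers_indicator_neq[OF assms] by blast
  have face: "G face_of P" "G \<noteq> {}" "G \<noteq> P" using G(1) facet_of_imp_face_of facet_of_irrefl
    unfolding facet_of_def by auto
  obtain c where c: "G = maximizers P c"
    using face_of_polytope_eq_maximizers[OF polytope face(1,2)] .
  have "c \<in> normal_cone P ?F"
    using G(2) c by (simp add: mem_normal_cone_iff maximizers_face)
  then obtain a b where ab: "c = a *\<^sub>R indicator_vec X + b *\<^sub>R 1" "a \<ge> 0"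
    unfolding normal_cone_indicator[OF assms] indicator_ray_def by blast
  have "a \<noteq> 0" using ab c face(3) maximizers_constant by auto
  then have "G = ?F" using ab c maximizers_affine[of a "indicator_vec X" b] by simp
  then show ?thesis using G by simp
qed

lemma facet_eq_maximizers_indicator:
  assumes "F facet_of P"
  obtains X where "X \<noteq> {}" "X \<noteq> UNIV" "F = maximizers P (indicator_vec X)"
proof -
  have face: "F face_of P" "F \<noteq> {}" "F \<noteq> P"
    using assms facet_of_imp_face_of facet_of_irrefl unfolding facet_of_def by auto
  obtain c where c: "F = maximizers P c"
    using face_of_polytope_eq_maximizers[OF polytope face(1,2)] .
  obtain v prec where v: "v \<in> F" "normal_cone P {v} = order_cone prec"
    using vertex_in_face face by metis
  have vP: "v \<in> P" using v face face_of_imp_subset by blast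
  define X where "X = {i. \<forall>j. c $ j \<le> c $ i}"
  have "X \<noteq> {}"
  proof -
    have "Max (range (($) c)) \<in> range (($) c)" by (intro Max_in) auto
    then obtain i where i: "c $ i = Max (range (($) c))" by (metis imageE)
    then have "i \<in> X" unfolding X_def by simp
    then show ?thesis by blast
  qed
  have "X \<noteq> UNIV"
  proof
    assume "X = UNIV"
    then have "c $ i = c $ undefined" for i unfolding X_def by (blast intro: antisym)
    then have "c = (c $ undefined) *\<^sub>R 1" unfolding vec_eq_iff by simp
    then show False using maximizers_constant c face(3) by metis
  qed
  have "c \<in> order_cone prec"
    using v c vP mem_normal_cone_iff[of "{v}" P c] by simp
  then obtain e where e: "e > 0" "indicator_vec X \<in> order_cone prec"
    "c - e *\<^sub>R indicator_vec X \<in> order_cone prec"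
    using top_level_set_perturbation X_def by metis
  \<comment> \<open>On \<open>F\<close> the functional \<open>c\<close> is constant, while
    \<open>v\<close> maximizes \<open>c - e *\<^sub>R indicator_vec X\<close>; so the indicator is
    at least as large on \<open>F\<close> as at \<open>v\<close>, where it is maximal over
    \<open>P\<close>.\<close>
  have "F \<subseteq> maximizers P (indicator_vec X)"
  proof
    fix x assume x: "x \<in> F"
    then have xP: "x \<in> P" using face face_of_imp_subset by blast
    have "c \<bullet> x = c \<bullet> v"
      using x v(1) unfolding c maximizers_def by (simp add: antisym)
    moreover have "(c - e *\<^sub>R indicator_vec X) \<bullet> x \<le> (c - e *\<^sub>R indicator_vec X) \<bullet> v"
      using e(3) xP unfolding v(2)[symmetric] normal_cone_def by simp
    ultimately have "indicator_vec X \<bullet> v \<le> indicator_vec X \<bullet> x"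
      using e(1) by (simp add: inner_diff_left)
    moreover have "indicator_vec X \<bullet> y \<le> indicator_vec X \<bullet> v" if "y \<in> P" for y
      using e(2) that unfolding v(2)[symmetric] normal_cone_def by simp
    ultimately show "x \<in> maximizers P (indicator_vec X)"
      using xP unfolding maximizers_def by (auto intro: order_trans)
  qed
  \<comment> \<open>Both are facets, so they have the same dimension, and a face of full dimension
    is the whole.\<close>
  moreover note facet = maximizers_indicator_facet[OF \<open>X \<noteq> {}\<close> \<open>X \<noteq> UNIV\<close>]
  ultimately have "F face_of maximizers P (indicator_vec X)"
    using face(1) face_of_subset facet facet_of_imp_subset by metis
  moreover have "convex (maximizers P (indicator_vec X))"
    using maximizers_face(1) face_of_imp_convex polytope polytope_imp_convex by blast
  moreover have "aff_dim F = aff_dim (maximizers P (indicator_vec X))"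
    using assms facet unfolding facet_of_def by simp
  ultimately have "F = maximizers P (indicator_vec X)"
    using face_of_aff_dim_lt by (metis less_irrefl)
  with \<open>X \<noteq> {}\<close> \<open>X \<noteq> UNIV\<close> show thesis by (rule that)
qed

lemma bij_betw_facets:
  "bij_betw (\<lambda>X. maximizers P (indicator_vec X)) {X. X \<noteq> {} \<and> X \<noteq> UNIV} {F. F facet_of P}"
  unfolding bij_betw_def
proof
  \<comment> \<open>The normal cone of the face recovers the ray, and the ray recovers
    \<open>X\<close>.\<close>
  show "inj_on (\<lambda>X. maximizers P (indicator_vec X)) {X. X \<noteq> {} \<and> X \<noteq> UNIV}"
    by (rule inj_onI) (metis (mono_tags, lifting) indicator_ray_inj mem_Collect_eq normal_cone_indicator)
  show "(\<lambda>X. maximizers P (indicator_vec X)) ` {X. X \<noteq> {} \<and> X \<noteq> UNIV} = {F. F facet_of P}"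
  proof (intro equalityI subsetI)
    fix F assume "F \<in> {F. F facet_of P}"
    then obtain X where "X \<noteq> {}" "X \<noteq> UNIV" "F = maximizers P (indicator_vec X)"
      using facet_eq_maximizers_indicator by blast
    then show "F \<in> (\<lambda>X. maximizers P (indicator_vec X)) ` {X. X \<noteq> {} \<and> X \<noteq> UNIV}" by simp
  qed (auto intro: maximizers_indicator_facet)
qed

end

lemma card_nonempty_proper_subsets:
  "card {X :: 'n::finite set. X \<noteq> {} \<and> X \<noteq> UNIV} = 2 ^ CARD('n) - 2"
proof -
  have "{X :: 'n set. X \<noteq> {} \<and> X \<noteq> UNIV} = Pow UNIV - {{}, UNIV}" by auto
  then show ?thesis by (simp add: card_Diff_subset card_Pow)
qed

section \<open>Tilings of a box\<close>

text \<open>Tiles are given by four coordinate functions on an index set instead of by rectangles,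
  so that reflecting or transposing the plane yields an instance of the same locale.\<close>

locale tiling =
  fixes S :: "'a set" and l r b t :: "'a \<Rightarrow> real" and L R B T :: real
  assumes finite: "finite S"
    and proper: "s \<in> S \<Longrightarrow> l s < r s \<and> b s < t s"
    and inside: "s \<in> S \<Longrightarrow> L \<le> l s \<and> r s \<le> R \<and> B \<le> b s \<and> t s \<le> T"
    and cover: "\<lbrakk>L \<le> x; x \<le> R; B \<le> y; y \<le> T\<rbrakk> \<Longrightarrow> \<exists>s\<in>S. l s \<le> x \<and> x \<le> r s \<and> b s \<le> y \<and> y \<le> t s"
    and disjoint: "\<lbrakk>s \<in> S; s' \<in> S; max (l s) (l s') < min (r s) (r s');
        max (b s) (b s') < min (t s) (t s')\<rbrakk> \<Longrightarrow> s = s'"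
begin

lemma reflected: "tiling S (\<lambda>s. - r s) (\<lambda>s. - l s) (\<lambda>s. - t s) (\<lambda>s. - b s) (- R) (- L) (- T) (- B)"
proof
  fix x y assume "- R \<le> x" "x \<le> - L" "- T \<le> y" "y \<le> - B"
  then have "\<exists>s\<in>S. l s \<le> - x \<and> - x \<le> r s \<and> b s \<le> - y \<and> - y \<le> t s"
    by (intro cover) auto
  then show "\<exists>s\<in>S. - r s \<le> x \<and> x \<le> - l s \<and> - t s \<le> y \<and> y \<le> - b s"
    by (auto simp: minus_le_iff le_minus_iff)
next
  fix s s' assume "s \<in> S" "s' \<in> S" "max (- r s) (- r s') < min (- l s) (- l s')"
    "max (- t s) (- t s') < min (- b s) (- b s')"
  then show "s = s'" by (intro disjoint) auto
qed (use finite proper inside in auto)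

lemma transposed: "tiling S b t l r B T L R"
proof
  fix x y assume "B \<le> x" "x \<le> T" "L \<le> y" "y \<le> R"
  then show "\<exists>s\<in>S. b s \<le> x \<and> x \<le> t s \<and> l s \<le> y \<and> y \<le> r s"
    using cover[of y x] by blast
qed (use finite proper inside disjoint in auto)

text \<open>Take a tile covering \<open>(x + e, y - e)\<close>, with \<open>e\<close> smaller than
  every distance from \<open>x\<close> to a left side on its right and from \<open>y\<close> to a
  top side below it; then no such side separates the tile from \<open>(x, y)\<close>.\<close>

lemma ex_tile_below_right:
  assumes "L \<le> x" "x < R" "B < y" "y \<le> T"
  obtains s where "s \<in> S" "l s \<le> x" "x < r s" "b s < y" "y \<le> t s"
proof -
  have small: "\<forall>\<^sub>F e in at_right 0. 0 < c \<longrightarrow> e < c" for c :: real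
    by (cases "c > 0") (auto intro: eventually_mono[OF eventually_at_right_real[of 0 c]])
  have "\<forall>\<^sub>F e in at_right 0. \<forall>s\<in>S. (0 < l s - x \<longrightarrow> e < l s - x) \<and> (0 < y - t s \<longrightarrow> e < y - t s)"
    by (intro eventually_ball_finite[OF finite] ballI eventually_conj small)
  then have "\<forall>\<^sub>F e in at_right 0. 0 < e \<and> (0 < R - x \<longrightarrow> e < R - x) \<and> (0 < y - B \<longrightarrow> e < y - B)
      \<and> (\<forall>s\<in>S. (0 < l s - x \<longrightarrow> e < l s - x) \<and> (0 < y - t s \<longrightarrow> e < y - t s))"
    by (intro eventually_conj small) (simp_all add: eventually_at_right_less)
  then obtain e where e: "0 < e" "e < R - x" "e < y - B"
    "\<And>s. s \<in> S \<Longrightarrow> x < l s \<Longrightarrow> e < l s - x" "\<And>s. s \<in> S \<Longrightarrow> t s < y \<Longrightarrow> e < y - t s"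
    using eventually_happens'[OF trivial_limit_at_right_real] assms(2,3) by (smt (verit))
  obtain s where s: "s \<in> S" "l s \<le> x + e" "x + e \<le> r s" "b s \<le> y - e" "y - e \<le> t s"
    using cover[of "x + e" "y - e"] e assms by auto
  have "l s \<le> x" "y \<le> t s" using e(4,5)[OF s(1)] s by force+
  with that s e(1) show thesis by simp
qed

text \<open>The two tiles at \<open>(r s, t s)\<close> to the lower right and to the upper left cannot both extend beyond
  that point, or they would overlap.\<close>

lemma corner_successor:
  assumes s: "s \<in> S" and "r s \<noteq> R \<or> t s \<noteq> T"
  obtains s' where "s' \<in> S" "(l s' = r s \<and> t s' = t s) \<or> (b s' = t s \<and> r s' = r s)"
proof -
  interpret transposed: tiling S b t l r B T L R by (rule transposed)
  have bounds: "L \<le> r s" "B < t s" "t s \<le> T" "B \<le> t s" "L < r s" "r s \<le> R"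
    using proper[OF s] inside[OF s] by linarith+
  \<comment> \<open>The tile just to the lower right of the corner would overlap \<open>s\<close> if
    it started left of \<open>r s\<close>.\<close>
  have right: "\<exists>u\<in>S. l u = r s \<and> b u < t s \<and> t s \<le> t u" if R: "r s < R"
  proof -
    obtain u where u: "u \<in> S" "l u \<le> r s" "r s < r u" "b u < t s" "t s \<le> t u"
      using ex_tile_below_right[OF bounds(1) R bounds(2,3)] by blast
    have "s = u" if "l u < r s"
      using disjoint[OF s u(1)] proper[OF s] u that by auto
    then have "l u = r s" using u(2,3) by (cases "l u < r s") auto
    with u show ?thesis by blast
  qed
  have up: "\<exists>u\<in>S. b u = t s \<and> l u < r s \<and> r s \<le> r u" if T: "t s < T"
  proof -
    obtain u where u: "u \<in> S" "b u \<le> t s" "t s < t u" "l u < r s" "r s \<le> r u"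
      using transposed.ex_tile_below_right[OF bounds(4) T bounds(5,6)] by blast
    have "s = u" if "b u < t s"
      using disjoint[OF s u(1)] proper[OF s] u that by auto
    then have "b u = t s" using u(2,3) by (cases "b u < t s") auto
    with u show ?thesis by blast
  qed
  consider "t s < T" "r s = R" | "t s = T" "r s < R" | "t s < T" "r s < R"
    using assms(2) bounds(3,6) by linarith
  then show thesis
  proof cases
    \<comment> \<open>For a corner on the right or top side of the box, that side stops the only
      neighbour exactly at the corner.\<close>
    case 1
    then obtain u where "u \<in> S" "b u = t s" "r s \<le> r u" using up by blast
    then show thesis using that[of u] inside[of u] 1 by simp
  next
    case 2
    then obtain u where "u \<in> S" "l u = r s" "t s \<le> t u" using right by blast
    then show thesis using that[of u] inside[of u] 2 by simp
  next
    case 3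
    obtain u v where u: "u \<in> S" "l u = r s" "b u < t s" "t s \<le> t u"
      and v: "v \<in> S" "b v = t s" "l v < r s" "r s \<le> r v"
      using right up 3 by blast
    have "u = v" if "t s < t u" "r s < r v"
      using disjoint[OF u(1) v(1)] proper[OF u(1)] proper[OF v(1)] u v that by auto
    then have "\<not> (t s < t u \<and> r s < r v)" using u(2) v(3) by auto
    then have "t u = t s \<or> r v = r s" using u(4) v(4) by linarith
    then show thesis using u(1,2) v(1,2) that[of u] that[of v] by blast
  qed
qed

text \<open>Passing to a corner successor increases \<open>r s + t s\<close>, so in a finite tiling
  every chain ends, and only at the tile in the corner \<open>(R, T)\<close>, which is unique by
  disjointness. The induction counts the tiles with a larger sum.\<close>

lemma ex_greatest:
  assumes "S \<noteq> {}"
    and E: "\<And>s s'. \<lbrakk>s \<in> S; s' \<in> S; (l s' = r s \<and> t s' = t s) \<or> (b s' = t s \<and> r s' = r s)\<rbrakk> \<Longrightarrow> E s s'"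
  obtains m where "m \<in> S" "\<And>s. s \<in> S \<Longrightarrow> s = m \<or> E\<^sup>+\<^sup>+ s m"
proof -
  have "L \<le> R" "B \<le> T" using assms(1) proper inside by (meson ex_in_conv less_imp_le order_trans)+
  then obtain m where m: "m \<in> S" "r m = R" "t m = T"
    using cover[of R T] inside by (metis order_antisym order_refl)
  have "s = m \<or> E\<^sup>+\<^sup>+ s m" if "s \<in> S" for s
    using that
  proof (induction "card {s' \<in> S. r s + t s < r s' + t s'}" arbitrary: s rule: less_induct)
    case less
    show ?case
    proof (cases "r s = R \<and> t s = T")
      case True
      then have "s = m"
        using disjoint[OF less.prems m(1)] proper[OF less.prems] proper[OF m(1)] m by simp
      then show ?thesis ..
    next
      case False
      then obtain u where u: "u \<in> S" "(l u = r s \<and> t u = t s) \<or> (b u = t s \<and> r u = r s)"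
        using corner_successor[OF less.prems] by metis
      have "r s + t s < r u + t u" using u proper[OF u(1)] by auto
      then have "card {s' \<in> S. r u + t u < r s' + t s'} < card {s' \<in> S. r s + t s < r s' + t s'}"
        using u finite by (intro psubset_card_mono) auto
      then have "u = m \<or> E\<^sup>+\<^sup>+ u m" using less.hyps u by blast
      moreover have "E s u" using E less.prems u by blast
      ultimately show ?thesis by (auto intro: tranclp_into_tranclp2)
    qed
  qed
  with m that show thesis by blast
qed

text \<open>Point reflection exchanges top-right and bottom-left corners, so this is
  \<open>ex_greatest\<close> for the converse of \<open>E\<close>.\<close>

lemma ex_least:
  assumes "S \<noteq> {}"
    and E: "\<And>s s'. \<lbrakk>s \<in> S; s' \<in> S; (r s = l s' \<and> b s = b s') \<or> (t s = b s' \<and> l s = l s')\<rbrakk> \<Longrightarrow> E s s'"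
  obtains m where "m \<in> S" "\<And>s. s \<in> S \<Longrightarrow> s = m \<or> E\<^sup>+\<^sup>+ m s"
proof -
  interpret reflected: tiling S "\<lambda>s. - r s" "\<lambda>s. - l s" "\<lambda>s. - t s" "\<lambda>s. - b s" "- R" "- L" "- T" "- B"
    by (rule reflected)
  obtain m where "m \<in> S" "\<And>s. s \<in> S \<Longrightarrow> s = m \<or> E\<inverse>\<inverse>\<^sup>+\<^sup>+ s m"
    using reflected.ex_greatest[OF assms(1), of "E\<inverse>\<inverse>"] E by auto
  then show thesis using that by (metis tranclp_converseD conversepD)
qed

end

section \<open>The posets of a rectangulation are bounded\<close>

lemma mem_region_iff:
  "p \<in> region s \<longleftrightarrow> x_left s \<le> fst p \<and> fst p \<le> x_right s \<and> y_bottom s \<le> snd p \<and> snd p \<le> y_top s"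
  unfolding region_def bottom_left_def top_right_def by (cases p) auto

lemma interior_region:
  "interior (region s) = {x_left s<..<x_right s} \<times> {y_bottom s<..<y_top s}"
  unfolding region_def bottom_left_def top_right_def by (simp add: interior_cbox box_prod)

lemma rectangulation_tiling:
  assumes R: "R \<in> rectangulations n" and r: "bij_betw r (UNIV :: 'n::finite set) R"
  obtains L R' B T where "tiling UNIV (\<lambda>i. x_left (r i)) (\<lambda>i. x_right (r i))
    (\<lambda>i. y_bottom (r i)) (\<lambda>i. y_top (r i)) L R' B T"
proof -
  obtain q where q: "(\<Union>s\<in>R. region s) = region q"
    using R unfolding rectangulations_def by blast
  have proper: "proper s" if "s \<in> R" for s
    using R that unfolding rectangulations_def by blast
  have rR: "r i \<in> R" for i using r by (auto simp: bij_betw_def)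
  have "tiling UNIV (\<lambda>i. x_left (r i)) (\<lambda>i. x_right (r i))
    (\<lambda>i. y_bottom (r i)) (\<lambda>i. y_top (r i)) (x_left q) (x_right q) (y_bottom q) (y_top q)"
  proof
    fix i
    show pr: "x_left (r i) < x_right (r i) \<and> y_bottom (r i) < y_top (r i)"
      using proper[OF rR] unfolding proper_def .
    have "(x_left (r i), y_bottom (r i)) \<in> region q" "(x_right (r i), y_top (r i)) \<in> region q"
      unfolding q[symmetric] using rR pr by (auto simp: mem_region_iff intro!: bexI[of _ "r i"])
    then show "x_left q \<le> x_left (r i) \<and> x_right (r i) \<le> x_right q
        \<and> y_bottom q \<le> y_bottom (r i) \<and> y_top (r i) \<le> y_top q"
      by (auto simp: mem_region_iff)
  next
    fix x y assume "x_left q \<le> x" "x \<le> x_right q" "y_bottom q \<le> y" "y \<le> y_top q"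
    then have "(x, y) \<in> (\<Union>s\<in>R. region s)" unfolding q by (simp add: mem_region_iff)
    then obtain i where "(x, y) \<in> region (r i)" using r by (auto simp: bij_betw_def)
    then show "\<exists>i\<in>UNIV. x_left (r i) \<le> x \<and> x \<le> x_right (r i) \<and> y_bottom (r i) \<le> y \<and> y \<le> y_top (r i)"
      by (auto simp: mem_region_iff)
  next
    fix i j
    assume "max (x_left (r i)) (x_left (r j)) < min (x_right (r i)) (x_right (r j))"
      "max (y_bottom (r i)) (y_bottom (r j)) < min (y_top (r i)) (y_top (r j))"
    then obtain x y where "max (x_left (r i)) (x_left (r j)) < x" "x < min (x_right (r i)) (x_right (r j))"
      "max (y_bottom (r i)) (y_bottom (r j)) < y" "y < min (y_top (r i)) (y_top (r j))"
      using dense by meson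
    then have "(x, y) \<in> interior (region (r i)) \<inter> interior (region (r j))"
      by (simp add: interior_region)
    then have "r i = r j"
      using R rR unfolding rectangulations_def pairwise_def by blast
    then show "i = j" using r by (auto simp: bij_betw_def inj_on_def)
  qed simp
  then show thesis by (rule that)
qed

text \<open>The hypotheses on \<open>E\<close> are the corner coincidences of
  \<open>corner_successor\<close> and of its point reflection; the weak and the strong poset differ
  only in why they contain them.\<close>

lemma bounded_prec_rectangulation:
  assumes R: "R \<in> rectangulations n" and r: "bij_betw r (UNIV :: 'n::finite set) R"
    and greatest: "\<And>i j. (x_left (r j) = x_right (r i) \<and> y_top (r j) = y_top (r i))
      \<or> (y_bottom (r j) = y_top (r i) \<and> x_right (r j) = x_right (r i)) \<Longrightarrow> E i j"
    and least: "\<And>i j. (x_right (r i) = x_left (r j) \<and> y_bottom (r i) = y_bottom (r j))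
      \<or> (y_top (r i) = y_bottom (r j) \<and> x_left (r i) = x_left (r j)) \<Longrightarrow> E i j"
  shows "bounded_prec E\<^sup>+\<^sup>+"
proof -
  obtain L R' B T where "tiling UNIV (\<lambda>i. x_left (r i)) (\<lambda>i. x_right (r i))
    (\<lambda>i. y_bottom (r i)) (\<lambda>i. y_top (r i)) L R' B T"
    using rectangulation_tiling[OF R r] .
  then interpret tiling UNIV "\<lambda>i. x_left (r i)" "\<lambda>i. x_right (r i)"
    "\<lambda>i. y_bottom (r i)" "\<lambda>i. y_top (r i)" L R' B T .
  obtain m where m: "\<And>i. i = m \<or> E\<^sup>+\<^sup>+ i m"
    using ex_greatest[of E] greatest by auto
  obtain m' where m': "\<And>i. i = m' \<or> E\<^sup>+\<^sup>+ m' i"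
    using ex_least[of E] least by auto
  from m m' show ?thesis unfolding bounded_prec_def by blast
qed

text \<open>In the first kind of coincidence \<open>top_right (r i)\<close> is a corner of
  \<open>r j\<close>, joined to \<open>top_right (r j)\<close> by a side of \<open>r j\<close>. In
  the second, \<open>bottom_left (r j)\<close> is a corner of \<open>r i\<close>, joined to
  \<open>bottom_left (r i)\<close> by a side of \<open>r i\<close>.\<close>

lemma bounded_prec_weak_less:
  assumes R: "R \<in> rectangulations n" and r: "bij_betw r UNIV R"
  shows "bounded_prec (weak_less R r)"
proof -
  have rR: "r i \<in> R" for i using r by (auto simp: bij_betw_def)
  show ?thesis
    unfolding weak_less_def
  proof (rule bounded_prec_rectangulation[OF R r])
    fix i j
    assume "(x_left (r j) = x_right (r i) \<and> y_top (r j) = y_top (r i))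
      \<or> (y_bottom (r j) = y_top (r i) \<and> x_right (r j) = x_right (r i))"
    then show "source_tree R r i j \<or> target_tree R r i j"
      using rR[of j] unfolding target_tree_def corner_arcs_def
      by (auto simp: top_right_def top_left_def bottom_right_def intro!: bexI[of _ "r j"])
  next
    fix i j
    assume "(x_right (r i) = x_left (r j) \<and> y_bottom (r i) = y_bottom (r j))
      \<or> (y_top (r i) = y_bottom (r j) \<and> x_left (r i) = x_left (r j))"
    then show "source_tree R r i j \<or> target_tree R r i j"
      using rR[of i] unfolding source_tree_def corner_arcs_def
      by (auto simp: bottom_left_def top_left_def bottom_right_def intro!: bexI[of _ "r i"])
  qed
qed

text \<open>Touching sides with a common lower, upper, left or right end overlap in positive length,
  as the rectangles are proper; so the coincidences give adjacencies.\<close>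

lemma bounded_prec_strong_less:
  assumes R: "R \<in> rectangulations n" and r: "bij_betw r UNIV R"
  shows "bounded_prec (strong_less R r)"
proof -
  have pr: "x_left (r i) < x_right (r i)" "y_bottom (r i) < y_top (r i)" for i
    using R r unfolding rectangulations_def proper_def bij_betw_def by blast+
  have adj: "adjacency_less r i j \<or> special R r i j"
    if "adjacent_left_right (r i) (r j) \<or> adjacent_bottom_top (r i) (r j)" for i j
    using that unfolding adjacency_less_def by blast
  show ?thesis
    unfolding strong_less_def
  proof (rule bounded_prec_rectangulation[OF R r]; rule adj)
    fix i j
    assume "(x_left (r j) = x_right (r i) \<and> y_top (r j) = y_top (r i))
      \<or> (y_bottom (r j) = y_top (r i) \<and> x_right (r j) = x_right (r i))"
    then show "adjacent_left_right (r i) (r j) \<or> adjacent_bottom_top (r i) (r j)"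
      using pr[of i] pr[of j] unfolding adjacent_left_right_def adjacent_bottom_top_def by auto
  next
    fix i j
    assume "(x_right (r i) = x_left (r j) \<and> y_bottom (r i) = y_bottom (r j))
      \<or> (y_top (r i) = y_bottom (r j) \<and> x_left (r i) = x_left (r j))"
    then show "adjacent_left_right (r i) (r j) \<or> adjacent_bottom_top (r i) (r j)"
      using pr[of i] pr[of j] unfolding adjacent_left_right_def adjacent_bottom_top_def by auto
  qed
qed

section \<open>Existence of rectangulations\<close>

definition label_index :: "'n::{finite,linorder} \<Rightarrow> nat" where
  "label_index i = card {..<i}"

lemma strict_mono_label_index: "strict_mono (label_index :: 'n::{finite,linorder} \<Rightarrow> nat)"
  unfolding strict_mono_def label_index_def by (auto intro!: psubset_card_mono)

lemma label_index_less_iff: "label_index i < label_index j \<longleftrightarrow> i < j"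
  using strict_mono_label_index by (rule strict_mono_less)

lemma label_index_eq_iff: "label_index i = label_index j \<longleftrightarrow> i = j"
  using strict_mono_label_index by (rule strict_mono_eq)

lemma range_label_index: "range (label_index :: 'n::{finite,linorder} \<Rightarrow> nat) = {..<CARD('n)}"
proof (rule card_subset_eq)
  show "range (label_index :: 'n \<Rightarrow> nat) \<subseteq> {..<CARD('n)}"
    unfolding label_index_def by (auto intro!: psubset_card_mono)
  have "inj (label_index :: 'n \<Rightarrow> nat)" by (simp add: inj_def label_index_eq_iff)
  then show "card (range (label_index :: 'n \<Rightarrow> nat)) = card {..<CARD('n)}"
    by (simp add: card_image)
qed simp

text \<open>The square cut into vertical strips of width one, ordered by label. They witness that
  there are cones at all, which rules out the empty polytope as a rectangulotope.\<close>

definition strip :: "'n::{finite,linorder} \<Rightarrow> rect" where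
  "strip i = Rect (real (label_index i)) (real (label_index i) + 1) 0 (real CARD('n))"

lemma strip_simps [simp]:
  "x_left (strip i) = real (label_index i)" "x_right (strip i) = real (label_index i) + 1"
  "y_bottom (strip i) = 0" "y_top (strip (i :: 'n::{finite,linorder})) = real CARD('n)"
  by (simp_all add: strip_def)

lemma strip_eq_iff: "strip i = strip j \<longleftrightarrow> i = j"
  by (simp add: strip_def label_index_eq_iff)

lemma region_strips:
  "(\<Union>s\<in>range (strip :: 'n::{finite,linorder} \<Rightarrow> rect). region s) = region (Rect 0 CARD('n) 0 CARD('n))"
proof (intro equalityI subsetI)
  fix p assume "p \<in> (\<Union>s\<in>range (strip :: 'n \<Rightarrow> rect). region s)"
  then obtain i :: 'n where i: "p \<in> region (strip i)" by blast
  have "label_index i < CARD('n)" using range_label_index by blast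
  then have "real (label_index i) + 1 \<le> real CARD('n)" by linarith
  with i show "p \<in> region (Rect 0 CARD('n) 0 CARD('n))" by (simp add: mem_region_iff)
next
  fix p assume p: "p \<in> region (Rect 0 CARD('n) 0 CARD('n))"
  \<comment> \<open>The minimum treats the right side of the square, where the floor is
    \<open>CARD('n)\<close>, one past the last strip.\<close>
  define k where "k = min (nat \<lfloor>fst p\<rfloor>) (CARD('n) - 1)"
  have "k < CARD('n)" unfolding k_def by (simp add: min_less_iff_disj)
  then obtain i :: 'n where i: "label_index i = k" using range_label_index by (metis imageE lessThan_iff)
  have "real k \<le> fst p" "fst p \<le> real k + 1"
    using p unfolding k_def mem_region_iff by (auto simp: min_def; linarith)+
  then have "p \<in> region (strip i)" using p i by (simp add: mem_region_iff)
  then show "p \<in> (\<Union>s\<in>range (strip :: 'n \<Rightarrow> rect). region s)" by blast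
qed

lemma strips_rectangulation:
  "range (strip :: 'n::{finite,linorder} \<Rightarrow> rect) \<in> rectangulations CARD('n)"
proof -
  let ?R = "range (strip :: 'n \<Rightarrow> rect)"
  have "card ?R = CARD('n)" by (rule card_image) (simp add: inj_def strip_eq_iff)
  moreover have "\<forall>s\<in>?R. proper s" by (auto simp: proper_def)
  moreover have "is_square (Rect 0 CARD('n) 0 CARD('n))"
    by (simp add: is_square_def proper_def)
  moreover have "pairwise (\<lambda>s s'. interior (region s) \<inter> interior (region s') = {}) ?R"
  proof (rule pairwiseI)
    fix s s' assume "s \<in> ?R" "s' \<in> ?R" "s \<noteq> s'"
    then obtain i j :: 'n where ij: "s = strip i" "s' = strip j" "label_index i \<noteq> label_index j"
      by (auto simp: strip_eq_iff label_index_eq_iff)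
    then show "interior (region s) \<inter> interior (region s') = {}"
      by (auto simp: interior_region)
  qed
  moreover have "generic ?R"
    unfolding generic_def
  proof clarify
    fix A p1 p2 assume A: "A \<subseteq> ?R" "card A = 4" "\<forall>s\<in>A. (p1, p2) \<in> corners s"
    \<comment> \<open>Corners of a strip have the abscissa of its left side or one more, and
      distinct strips have distinct left sides; so at most two strips share a corner.\<close>
    have "x_left ` A \<subseteq> {p1, p1 - 1}"
      using A(1,3) by (fastforce simp: corners_def bottom_left_def bottom_right_def top_left_def top_right_def)
    moreover have "inj_on x_left A"
    proof (rule inj_onI)
      fix s s' assume "s \<in> A" "s' \<in> A" "x_left s = x_left s'"
      moreover then obtain i j :: 'n where "s = strip i" "s' = strip j" using A(1) by blast
      ultimately show "s = s'" by (simp add: strip_eq_iff label_index_eq_iff)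
    qed
    ultimately have "card A \<le> card {p1, p1 - 1}" by (intro card_inj_on_le) auto
    also have "\<dots> \<le> 2" by (simp add: card_insert_if)
    finally show False using A(2) by simp
  qed
  ultimately show ?thesis
    using region_strips[where 'n = 'n] unfolding rectangulations_def
    by (intro CollectI conjI exI[of _ "Rect 0 CARD('n) 0 CARD('n)"]) (assumption | simp)+
qed

section \<open>Segments and labeling of the strips\<close>

lemma linear_constant_on_closed_segment:
  fixes f :: "'a::real_vector \<Rightarrow> real"
  assumes "linear f" "p \<in> closed_segment a b" "q \<in> closed_segment a b" "p \<noteq> q" "f p = f q"
    and x: "x \<in> closed_segment a b"
  shows "f x = f p"
proof -
  have f: "f ((1 - u) *\<^sub>R a + u *\<^sub>R b) = f a + u * (f b - f a)" for u
    unfolding linear_add[OF assms(1)] linear_scale[OF assms(1)] by (simp add: algebra_simps)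
  obtain u v w where u: "p = (1 - u) *\<^sub>R a + u *\<^sub>R b" and v: "q = (1 - v) *\<^sub>R a + v *\<^sub>R b"
    and w: "x = (1 - w) *\<^sub>R a + w *\<^sub>R b"
    using assms(2,3) x unfolding in_segment by blast
  \<comment> \<open>\<open>f\<close> is affine in the parameter, and equal values at two distinct
    parameters force slope zero.\<close>
  have "u \<noteq> v" using assms(4) u v by blast
  then have "f b = f a" using assms(5) unfolding u v f by simp
  then show ?thesis unfolding u w f by simp
qed

lemma right_left_edges_in_line:
  assumes "proper s" "right_edge s \<subseteq> closed_segment a b" "left_edge s' \<subseteq> closed_segment a b"
  shows "x_left s' = x_right s"
proof -
  have *: "bottom_right s \<in> closed_segment a b" "top_right s \<in> closed_segment a b"
    "bottom_left s' \<in> closed_segment a b"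
    using assms(2,3) unfolding right_edge_def left_edge_def by auto
  have "fst (bottom_left s') = fst (bottom_right s)"
    by (rule linear_constant_on_closed_segment[OF linear_fst *(1,2) _ _ *(3)])
      (use assms(1) in \<open>auto simp: bottom_right_def top_right_def proper_def\<close>)
  then show ?thesis by (simp add: bottom_left_def bottom_right_def)
qed

lemma bottom_top_edges_in_line:
  assumes "proper s" "bottom_edge s \<subseteq> closed_segment a b" "top_edge s' \<subseteq> closed_segment a b"
  shows "y_top s' = y_bottom s"
proof -
  have *: "bottom_left s \<in> closed_segment a b" "bottom_right s \<in> closed_segment a b"
    "top_left s' \<in> closed_segment a b"
    using assms(2,3) unfolding bottom_edge_def top_edge_def by auto
  have "snd (top_left s') = snd (bottom_left s)"
    by (rule linear_constant_on_closed_segment[OF linear_snd *(1,2) _ _ *(3)])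
      (use assms(1) in \<open>auto simp: bottom_right_def bottom_left_def proper_def\<close>)
  then show ?thesis by (simp add: bottom_left_def top_left_def)
qed

lemma edge_subset_region:
  assumes "proper s" "e \<in> edges s"
  shows "e \<subseteq> region s"
proof -
  have "convex (region s)" unfolding region_def by (rule convex_box)
  then have "closed_segment p q \<subseteq> region s" if "p \<in> corners s" "q \<in> corners s" for p q
    using that assms(1)
    by (intro closed_segment_subset) (auto simp: corners_def proper_def mem_region_iff
        bottom_left_def bottom_right_def top_left_def top_right_def)
  then show ?thesis
    using assms(2) unfolding corners_def edges_def left_edge_def right_edge_def bottom_edge_def top_edge_def
    by blast
qed

lemma right_edge_strip: "right_edge (strip (i :: 'n)) = {real (label_index i) + 1} \<times> {0..real CARD('n::{finite,linorder})}"
  unfolding right_edge_def bottom_right_def top_right_def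
  by (simp add: closed_segment_same_fst closed_segment_eq_real_ivl)

lemma left_edge_strip: "left_edge (strip (i :: 'n)) = {real (label_index i)} \<times> {0..real CARD('n::{finite,linorder})}"
  unfolding left_edge_def bottom_left_def top_left_def
  by (simp add: closed_segment_same_fst closed_segment_eq_real_ivl)

text \<open>A longer line would still be vertical and inside the square, whose full height the edge
  already spans. Since \<open>j\<close> follows \<open>i\<close>, the edge is not on the boundary of
  the square, as its midpoint shows.\<close>

lemma right_edge_strip_segment:
  fixes i j :: "'n::{finite,linorder}"
  assumes "i < j"
  shows "right_edge (strip i) \<in> segments (range (strip :: 'n \<Rightarrow> rect))"
proof -
  let ?R = "range (strip :: 'n \<Rightarrow> rect)" and ?e = "right_edge (strip i)"
  have pos: "0 < real CARD('n)" by simp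
  have "line_of_edges ?R ?e"
    unfolding line_of_edges_def
  proof
    show "\<exists>a b. a \<noteq> b \<and> ?e = closed_segment a b"
      unfolding right_edge_def
      by (intro exI[of _ "bottom_right (strip i)"] exI[of _ "top_right (strip i)"])
         (simp add: bottom_right_def top_right_def)
    show "\<exists>E\<subseteq>\<Union>s\<in>?R. edges s. ?e = \<Union> E"
      by (rule exI[of _ "{?e}"]) (auto simp: edges_def)
  qed
  moreover have "m = ?e" if m: "line_of_edges ?R m" "?e \<subseteq> m" for m
  proof
    obtain a b where ab: "m = closed_segment a b" using m(1) unfolding line_of_edges_def by blast
    have sub: "m \<subseteq> region (Rect 0 CARD('n) 0 CARD('n))"
    proof -
      obtain E where E: "E \<subseteq> (\<Union>s\<in>?R. edges s)" "m = \<Union> E"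
        using m(1) unfolding line_of_edges_def by blast
      have "e \<subseteq> (\<Union>s\<in>?R. region s)" if e: "e \<in> E" for e
      proof -
        obtain k :: 'n where "e \<in> edges (strip k)" using E(1) e by blast
        then have "e \<subseteq> region (strip k)" by (intro edge_subset_region) (auto simp: proper_def)
        then show ?thesis by blast
      qed
      then show ?thesis unfolding E(2) region_strips[symmetric] by blast
    qed
    have "(real (label_index i) + 1, 0) \<in> m" "(real (label_index i) + 1, real CARD('n)) \<in> m"
      using m(2) by (auto simp: right_edge_strip)
    then have "fst x = real (label_index i) + 1" if "x \<in> m" for x
      using linear_constant_on_closed_segment[OF linear_fst, of "(real (label_index i) + 1, 0)" a b "(real (label_index i) + 1, real CARD('n))" x] that
      unfolding ab by simp
    with sub show "m \<subseteq> ?e" unfolding right_edge_strip by (fastforce simp: mem_region_iff)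
  qed (rule m(2))
  moreover have "\<not> ?e \<subseteq> frontier (\<Union>s\<in>?R. region s)"
  proof -
    have "label_index i < label_index j" "label_index j < CARD('n)"
      using assms label_index_less_iff range_label_index by blast+
    then have "real (label_index i) + 1 < real CARD('n)" by linarith
    then have "(real (label_index i) + 1, real CARD('n) / 2) \<in> interior (region (Rect 0 CARD('n) 0 CARD('n)))"
      by (simp add: interior_region)
    moreover have "(real (label_index i) + 1, real CARD('n) / 2) \<in> ?e"
      by (simp add: right_edge_strip)
    ultimately show ?thesis unfolding region_strips frontier_def by blast
  qed
  ultimately show ?thesis unfolding segments_def by blast
qed

lemma labeling_strips:
  "labeling (range (strip :: 'n \<Rightarrow> rect)) (strip :: 'n::{finite,linorder} \<Rightarrow> rect)"
proof -
  let ?R = "range (strip :: 'n \<Rightarrow> rect)"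
  have segD: "\<exists>a b. l = closed_segment a b" if "l \<in> segments ?R" for l
    using that unfolding segments_def line_of_edges_def by blast
  have proper: "proper (strip i)" for i :: 'n by (simp add: proper_def)
  \<comment> \<open>One step of \<open>above\<close> would place a bottom edge and a top edge on one
    horizontal line, but these lie at heights 0 and \<open>CARD('n)\<close>.\<close>
  have "\<not> above ?R s s'" for s s'
  proof
    assume "above ?R s s'"
    then obtain i j :: 'n and l where "l \<in> segments ?R" "bottom_edge (strip i) \<subseteq> l" "top_edge (strip j) \<subseteq> l"
      unfolding above_def by (induction rule: tranclp_induct) auto
    then have "y_top (strip j) = y_bottom (strip i)"
      using segD bottom_top_edges_in_line[OF proper] by metis
    then show False by simp
  qed
  moreover have "x_left s < x_left s'" if "left_of ?R s s'" for s s'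
  proof -
    have step: "x_left s < x_left s'"
      if s: "s \<in> ?R \<and> s' \<in> ?R \<and> (\<exists>l\<in>segments ?R. right_edge s \<subseteq> l \<and> left_edge s' \<subseteq> l)" for s s'
    proof -
      obtain i :: 'n where i: "s = strip i" using s by blast
      have "x_left s' = x_right (strip i)"
        using s segD right_left_edges_in_line[OF proper] unfolding i by metis
      then show ?thesis unfolding i by simp
    qed
    show ?thesis
      using that unfolding left_of_def
      by (induction rule: tranclp_induct) (blast intro: step less_trans)+
  qed
  then have "i < j" if "left_of ?R (strip i) (strip j)" for i j :: 'n
    using that label_index_less_iff by fastforce
  moreover have "left_of ?R (strip i) (strip j)" if "i < j" for i j :: 'n
    using that
  \<comment> \<open>The step passes from \<open>j\<close> to the strip \<open>h\<close> directly
    before it, whose right edge is the left edge of \<open>strip j\<close>.\<close>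
  proof (induction "label_index j" arbitrary: j)
    case 0
    then show ?case using label_index_less_iff by (metis not_less_zero)
  next
    case (Suc k)
    have "k < CARD('n)" using range_label_index Suc.hyps(2) by (metis Suc_lessD lessThan_iff rangeI)
    then obtain h :: 'n where h: "label_index h = k" using range_label_index by (metis imageE lessThan_iff)
    then have "h < j" using Suc.hyps(2) label_index_less_iff[of h j] by simp
    have "right_edge (strip h) = left_edge (strip j)"
      unfolding right_edge_strip left_edge_strip using h Suc.hyps(2)[symmetric] by (simp add: add.commute)
    then have step: "strip h \<in> ?R \<and> strip j \<in> ?R \<and>
        (\<exists>l\<in>segments ?R. right_edge (strip h) \<subseteq> l \<and> left_edge (strip j) \<subseteq> l)"
      using right_edge_strip_segment[OF \<open>h < j\<close>] by auto
    show ?case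
    proof (cases "i = h")
      case True
      then show ?thesis unfolding left_of_def using step by (intro tranclp.r_into_trancl) simp
    next
      case False
      have "label_index i < Suc k" using Suc.prems label_index_less_iff Suc.hyps(2) by metis
      then have "i < h" using False h label_index_eq_iff label_index_less_iff by (metis less_Suc_eq)
      then have "left_of ?R (strip i) (strip h)" using Suc.hyps(1) h by blast
      then show ?thesis unfolding left_of_def using step by (rule tranclp.trancl_into_trancl)
    qed
  qed
  moreover have "bij_betw strip (UNIV :: 'n set) ?R"
    by (simp add: bij_betw_def inj_def strip_eq_iff)
  ultimately show ?thesis unfolding labeling_def by blast
qed

text \<open>Reflexivity puts \<open>x\<close> into its own class, and every class stays inside
  \<open>A\<close>. Thus the cones are indexed by rectangulations instead of classes.\<close>

lemma Union_quotient_restricted: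
  assumes "x \<in> A \<Longrightarrow> P x x"
  shows "(\<exists>W \<in> A // {(x, y). x \<in> A \<and> y \<in> A \<and> P x y}. x \<in> W) \<longleftrightarrow> x \<in> A"
  using assms unfolding quotient_def by auto

lemma mem_weak_rectangulation_iff:
  "(\<exists>W\<in>weak_rectangulations n. R \<in> W) \<longleftrightarrow> R \<in> rectangulations n"
  unfolding weak_rectangulations_def
  by (rule Union_quotient_restricted)
     (auto simp: weakly_equivalent_def weak_bijection_def intro!: exI[of _ id])

lemma mem_strong_rectangulation_iff:
  "(\<exists>W\<in>strong_rectangulations n. R \<in> W) \<longleftrightarrow> R \<in> rectangulations n"
  unfolding strong_rectangulations_def
  by (rule Union_quotient_restricted)
     (auto simp: strongly_equivalent_def weak_bijection_def intro!: exI[of _ id])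

section \<open>The facets of the rectangulotopes\<close>

lemma cones_nonempty: "weak_cones \<noteq> {}" "strong_cones \<noteq> {}"
  using strips_rectangulation labeling_strips
  unfolding weak_cones_def strong_cones_def
    mem_weak_rectangulation_iff mem_strong_rectangulation_iff by blast+

lemma cones_bounded:
  assumes "C \<in> weak_cones \<union> strong_cones"
  shows "\<exists>prec. C = order_cone prec \<and> bounded_prec prec"
  using assms bounded_prec_weak_less bounded_prec_strong_less
  unfolding weak_cones_def strong_cones_def labeling_def
    mem_weak_rectangulation_iff mem_strong_rectangulation_iff by blast

text \<open>The normal cone of a vertex is a maximal cone of the fan and so the cone of a labeled
  rectangulation. The empty polytope is excluded because its normal fan is empty.\<close>

lemma order_cone_polytope_rectangulotope:
  assumes "weak_rectangulotope P \<or> strong_rectangulotope P"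
  shows "order_cone_polytope P"
proof
  show poly: "polytope P"
    using assms unfolding weak_rectangulotope_def strong_rectangulotope_def by blast
  have cones: "maximal_cones (normal_fan P) = weak_cones \<or> maximal_cones (normal_fan P) = strong_cones"
    using assms unfolding weak_rectangulotope_def strong_rectangulotope_def by blast
  show "P \<noteq> {}"
  proof
    assume "P = {}"
    then have "maximal_cones (normal_fan P) = {}"
      unfolding maximal_cones_def normal_fan_def by auto
    then show False using cones cones_nonempty by metis
  qed
  fix v assume "v extreme_point_of P"
  then have "normal_cone P {v} \<in> weak_cones \<union> strong_cones"
    using normal_cone_vertex_maximal[OF poly] cones by blast
  then show "\<exists>prec. normal_cone P {v} = order_cone prec \<and> bounded_prec prec"
    by (rule cones_bounded)
qed

theorem mainTheorem3:
  fixes P :: "(real ^ 'n::{finite,linorder}) set"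
  assumes "CARD('n) \<ge> 2"
    and "weak_rectangulotope P \<or> strong_rectangulotope P"
  shows "card {F. F facet_of P} = 2 ^ CARD('n) - 2
    \<and> (\<exists>facet. bij_betw facet {X :: 'n set. X \<noteq> {} \<and> X \<noteq> UNIV} {F. F facet_of P}
         \<and> (\<forall>X. X \<noteq> {} \<and> X \<noteq> UNIV \<longrightarrow>
              outer_normal_mod_one P (facet X) (\<Sum>i\<in>X. axis i 1)))"
proof (intro conjI exI[of _ "\<lambda>X. maximizers P (indicator_vec X)"] allI impI)
  interpret order_cone_polytope P
    using assms(2) by (rule order_cone_polytope_rectangulotope)
  show bij: "bij_betw (\<lambda>X. maximizers P (indicator_vec X)) {X. X \<noteq> {} \<and> X \<noteq> UNIV} {F. F facet_of P}"
    by (rule bij_betw_facets)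
  show "card {F. F facet_of P} = 2 ^ CARD('n) - 2"
    using bij_betw_same_card[OF bij] card_nonempty_proper_subsets by metis
  show "outer_normal_mod_one P (maximizers P (indicator_vec X)) (\<Sum>i\<in>X. axis i 1)"
    if "X \<noteq> {} \<and> X \<noteq> UNIV" for X
    using that normal_cone_indicator unfolding outer_normal_mod_one_def indicator_ray_def by blast
qed

end
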